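(* For every integer $m\ge 0$, the border rank of the tensor $$T_{HW,m}=6a_1a_2b_0+3a_1^2b_1+3a_2^2b_2+6\sum_{j=1}^{m}(a_1x_jy_j+a_2x_jz_j)\in S^3(V)\subseteq V\otimes V\otimes V$$ is equal to $3m+5$, where $V$ is the $(3m+5)$-dimensional complex vector space with basis $\{a_1,a_2,x_1,\ldots,x_m,y_1,\ldots,y_m,z_1,\ldots,z_m,b_0,b_1,b_2\}$.
   Context: For elements $x,y,z$ of a vector space $V$, the product $xyz$ denotes the symmetric tensor $\frac16(x\otimes y\otimes z+x\otimes z\otimes y+y\otimes x\otimes z+y\otimes z\otimes x+z\otimes x\otimes y+z\otimes y\otimes x)\in V\otimes V\otimes V$. The border rank of a tensor $T\in V\otimes V\otimes V$ is the least $r$ such that $T$ is a limit of tensors of rank at most $r$ (the rank being the least number of summands $u\otimes v\otimes w$ in an expression of the tensor). *)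

theory Defs
  imports Complex_Main
begin

text \<open>For a finite set \<^term>\<open>I\<close> of basis labels, the complex vector space with basis \<^term>\<open>I\<close> is
  the space of functions supported on \<^term>\<open>I\<close>, and its third tensor power is the space of
  coordinate arrays supported on \<open>I \<times> I \<times> I\<close>.\<close>

definition vec_space :: "'i set \<Rightarrow> ('i \<Rightarrow> complex) set" where
  "vec_space I = {v. \<forall>i. i \<notin> I \<longrightarrow> v i = 0}"

type_synonym 'i tensor3 = "'i \<Rightarrow> 'i \<Rightarrow> 'i \<Rightarrow> complex"

definition tensor_space :: "'i set \<Rightarrow> 'i tensor3 set" where
  "tensor_space I = {T. \<forall>i j k. \<not> (i \<in> I \<and> j \<in> I \<and> k \<in> I) \<longrightarrow> T i j k = 0}"

definition basis_vec :: "'i \<Rightarrow> 'i \<Rightarrow> complex" where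
  "basis_vec i = (\<lambda>j. if j = i then 1 else 0)"

definition tensor_prod :: "('i \<Rightarrow> complex) \<Rightarrow> ('i \<Rightarrow> complex) \<Rightarrow> ('i \<Rightarrow> complex) \<Rightarrow> 'i tensor3" where
  "tensor_prod u v w = (\<lambda>i j k. u i * v j * w k)"

definition sym_prod :: "('i \<Rightarrow> complex) \<Rightarrow> ('i \<Rightarrow> complex) \<Rightarrow> ('i \<Rightarrow> complex) \<Rightarrow> 'i tensor3" where
  "sym_prod x y z = (\<lambda>i j k. 1/6 *
     (tensor_prod x y z i j k + tensor_prod x z y i j k + tensor_prod y x z i j k
      + tensor_prod y z x i j k + tensor_prod z x y i j k + tensor_prod z y x i j k))"

definition is_sum_of_products :: "'i set \<Rightarrow> 'i tensor3 \<Rightarrow> nat \<Rightarrow> bool" where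
  "is_sum_of_products I T r \<longleftrightarrow>
     (\<exists>u v w. (\<forall>l<r. u l \<in> vec_space I \<and> v l \<in> vec_space I \<and> w l \<in> vec_space I) \<and>
        T = (\<lambda>i j k. \<Sum>l<r. tensor_prod (u l) (v l) (w l) i j k))"

definition tensor_rank :: "'i set \<Rightarrow> 'i tensor3 \<Rightarrow> nat" where
  "tensor_rank I T = (LEAST r. is_sum_of_products I T r)"

text \<open>Convergence in the finite-dimensional space \<^term>\<open>tensor_space I\<close> is convergence of all
  coordinates.\<close>

definition is_limit_of_rank_le :: "'i set \<Rightarrow> 'i tensor3 \<Rightarrow> nat \<Rightarrow> bool" where
  "is_limit_of_rank_le I T r \<longleftrightarrow>
     (\<exists>S :: nat \<Rightarrow> 'i tensor3.
        (\<forall>n. S n \<in> tensor_space I \<and> tensor_rank I (S n) \<le> r) \<and>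
        (\<forall>i j k. (\<lambda>n. S n i j k) \<longlonglongrightarrow> T i j k))"

definition border_rank :: "'i set \<Rightarrow> 'i tensor3 \<Rightarrow> nat" where
  "border_rank I T = (LEAST r. is_limit_of_rank_le I T r)"

datatype hw_label = A1 | A2 | Xj nat | Yj nat | Zj nat | B0 | B1 | B2

definition hw_basis :: "nat \<Rightarrow> hw_label set" where
  "hw_basis m = {A1, A2} \<union> Xj ` {1..m} \<union> Yj ` {1..m} \<union> Zj ` {1..m} \<union> {B0, B1, B2}"

definition T_HW :: "nat \<Rightarrow> hw_label tensor3" where
  "T_HW m =
    (let a1 = basis_vec A1; a2 = basis_vec A2;
         x = (\<lambda>j. basis_vec (Xj j)); y = (\<lambda>j. basis_vec (Yj j)); z = (\<lambda>j. basis_vec (Zj j));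
         b0 = basis_vec B0; b1 = basis_vec B1; b2 = basis_vec B2
     in (\<lambda>p q r. 6 * sym_prod a1 a2 b0 p q r + 3 * sym_prod a1 a1 b1 p q r
           + 3 * sym_prod a2 a2 b2 p q r
           + 6 * (\<Sum>j=1..m. sym_prod a1 (x j) (y j) p q r + sym_prod a2 (x j) (z j) p q r)))"

lemma finite_hw_basis: "finite (hw_basis m)"
  by (simp add: hw_basis_def)

lemma card_hw_basis: "card (hw_basis m) = 3 * m + 5"
proof -
  have c: "card (Xj ` {1..m}) = m" "card (Yj ` {1..m}) = m" "card (Zj ` {1..m}) = m"
    by (simp_all add: card_image inj_on_def)
  have "card (Xj ` {1..m} \<union> (Yj ` {1..m} \<union> Zj ` {1..m})) = 3 * m"
    by (subst card_Un_disjoint; (subst card_Un_disjoint)?) (auto simp: c simp del: One_nat_def)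
  moreover have "hw_basis m =
      insert A1 (insert A2 (insert B0 (insert B1 (insert B2
        (Xj ` {1..m} \<union> (Yj ` {1..m} \<union> Zj ` {1..m}))))))"
    by (auto simp: hw_basis_def)
  ultimately show ?thesis
    by (simp add: image_iff)
qed

lemma T_HW_in_tensor_space: "T_HW m \<in> tensor_space (hw_basis m)"
proof -
  have s: "sym_prod (basis_vec a) (basis_vec b) (basis_vec c) i j k = 0"
    if "a \<in> I" "b \<in> I" "c \<in> I" "\<not> (i \<in> I \<and> j \<in> I \<and> k \<in> I)" for a b c i j k and I :: "hw_label set"
    using that by (auto simp: sym_prod_def tensor_prod_def basis_vec_def)
  have m: "A1 \<in> hw_basis m" "A2 \<in> hw_basis m" "B0 \<in> hw_basis m" "B1 \<in> hw_basis m" "B2 \<in> hw_basis m"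
    by (auto simp: hw_basis_def)
  have n: "Xj j \<in> hw_basis m" "Yj j \<in> hw_basis m" "Zj j \<in> hw_basis m" if "j \<in> {1..m}" for j
    using that by (auto simp: hw_basis_def)
  show ?thesis
    unfolding tensor_space_def T_HW_def Let_def
    by (auto simp: s[where I = "hw_basis m"] m n intro!: sum.neutral)
qed

lemma T_HW_symmetric: "T_HW m i j k = T_HW m j i k" "T_HW m i j k = T_HW m i k j"
  by (simp_all add: T_HW_def sym_prod_def tensor_prod_def Let_def algebra_simps)

text \<open>The minima defining rank and border rank range over nonempty sets.\<close>

lemma ex_is_sum_of_products:
  assumes "finite I" and T: "T \<in> tensor_space I"
  shows "\<exists>r. is_sum_of_products I T r"
proof -
  let ?P = "I \<times> I \<times> I"
  have fin: "finite ?P" using assms by simp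
  obtain h where h: "bij_betw h {..<card ?P} ?P"
    using ex_bij_betw_nat_finite[OF fin] by (auto simp: atLeast0LessThan)
  define u where "u p = (case p of (a, b, c) \<Rightarrow> (\<lambda>i. T a b c * basis_vec a i))" for p
  define v where "v p = (case p of (a, b, c) \<Rightarrow> basis_vec b)" for p :: "'a \<times> 'a \<times> 'a"
  define w where "w p = (case p of (a, b, c) \<Rightarrow> basis_vec c)" for p :: "'a \<times> 'a \<times> 'a"
  have "T i j k = (\<Sum>l<card ?P. tensor_prod (u (h l)) (v (h l)) (w (h l)) i j k)" for i j k
  proof -
    have "(\<Sum>l<card ?P. tensor_prod (u (h l)) (v (h l)) (w (h l)) i j k)
        = (\<Sum>p\<in>?P. tensor_prod (u p) (v p) (w p) i j k)"
      using sum.reindex_bij_betw[OF h, of "\<lambda>p. tensor_prod (u p) (v p) (w p) i j k"] .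
    also have "\<dots> = (\<Sum>p\<in>?P. if p = (i, j, k) then T i j k else 0)"
      by (rule sum.cong) (auto simp: u_def v_def w_def tensor_prod_def basis_vec_def split: if_splits)
    also have "\<dots> = T i j k"
      using T fin by (auto simp: tensor_space_def)
    finally show ?thesis by simp
  qed
  then have eq: "T = (\<lambda>i j k. \<Sum>l<card ?P. tensor_prod (u (h l)) (v (h l)) (w (h l)) i j k)"
    by (intro ext)
  have "u (h l) \<in> vec_space I \<and> v (h l) \<in> vec_space I \<and> w (h l) \<in> vec_space I"
    if "l < card ?P" for l
  proof -
    have "h l \<in> ?P" using h that by (auto simp: bij_betw_def)
    then show ?thesis
      by (auto simp: u_def v_def w_def vec_space_def basis_vec_def)
  qed
  then have mem: "\<forall>l<card ?P. u (h l) \<in> vec_space I \<and> v (h l) \<in> vec_space I \<and> w (h l) \<in> vec_space I"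
    by blast
  have "is_sum_of_products I T (card ?P)"
    unfolding is_sum_of_products_def
    apply (rule exI[of _ "\<lambda>l. u (h l)"], rule exI[of _ "\<lambda>l. v (h l)"], rule exI[of _ "\<lambda>l. w (h l)"])
    by (rule conjI[OF mem eq])
  then show ?thesis ..
qed

lemma is_limit_of_rank_le_tensor_rank:
  assumes "T \<in> tensor_space I"
  shows "is_limit_of_rank_le I T (tensor_rank I T)"
  unfolding is_limit_of_rank_le_def using assms by (intro exI[of _ "\<lambda>_. T"]) auto

end

theory Submission imports Defs begin

text \<open>
  Lower bound: every basis vector is isolated by a single coordinate pair of \<open>T_HW m\<close>, so the
  flattening of \<open>T_HW m\<close> contains an identity matrix of size \<open>3m + 5\<close>. A nearby tensor has there a
  strictly diagonally dominant matrix, whereas a sum of fewer products has a linear relation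
  between its slices.

  Upper bound: write \<open>q\<close> for the three vectors \<open>a\<^sub>1\<close>, \<open>a\<^sub>1 + a\<^sub>2\<close>, \<open>a\<^sub>1 - a\<^sub>2\<close>. Any sum
  \<open>\<Sum> q\<^sup>2 e\<^sub>q\<close> has border rank at most 5: perturb the three cubes of the \<open>q\<close> in the linear relation
  between the cubes of \<open>q\<close> and \<open>a\<^sub>1 \<plusminus> 2a\<^sub>2\<close>. Each further term \<open>q l\<^sup>2\<close> costs one cube \<open>(q + t l)\<^sup>3\<close>,
  since the terms \<open>q\<^sup>3\<close> and \<open>q\<^sup>2 l\<close> are absorbed in \<open>e\<^sub>q\<close>. Finally
  \<open>2x (a\<^sub>1 y + a\<^sub>2 z)\<close> is a limit of combinations of three terms \<open>q l\<^sup>2\<close>, one for each \<open>q\<close>, as the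
  tangent vectors to the squares \<open>x\<^sup>2\<close> can be chosen freely once
  \<open>(a\<^sub>1 + a\<^sub>2) + (a\<^sub>1 - a\<^sub>2) - 2a\<^sub>1 = 0\<close> removes the leading term.
\<close>

section \<open>Sums of products and their limits\<close>

lemma is_sum_of_products_add:
  assumes "is_sum_of_products I S r" "is_sum_of_products I T s"
  shows "is_sum_of_products I (\<lambda>i j k. S i j k + T i j k) (r + s)"
proof -
  obtain u v w where 1: "\<forall>l<r. u l \<in> vec_space I \<and> v l \<in> vec_space I \<and> w l \<in> vec_space I"
    "S = (\<lambda>i j k. \<Sum>l<r. tensor_prod (u l) (v l) (w l) i j k)"
    using assms(1) unfolding is_sum_of_products_def by blast
  obtain u' v' w' where 2: "\<forall>l<s. u' l \<in> vec_space I \<and> v' l \<in> vec_space I \<and> w' l \<in> vec_space I"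
    "T = (\<lambda>i j k. \<Sum>l<s. tensor_prod (u' l) (v' l) (w' l) i j k)"
    using assms(2) unfolding is_sum_of_products_def by blast
  define app where "app f g l = (if l < r then f l else g (l - r))"
    for f g :: "nat \<Rightarrow> 'a \<Rightarrow> complex" and l
  have split: "(\<Sum>l<r + s. h l) = (\<Sum>l<r. h l) + (\<Sum>l<s. h (r + l))" for h :: "nat \<Rightarrow> complex"
    by (induction s) (simp_all add: add.assoc)
  have "\<forall>l<r + s. app u u' l \<in> vec_space I \<and> app v v' l \<in> vec_space I \<and> app w w' l \<in> vec_space I"
    using 1(1) 2(1) by (auto simp: app_def)
  moreover have "(\<lambda>i j k. S i j k + T i j k) =
      (\<lambda>i j k. \<Sum>l<r + s. tensor_prod (app u u' l) (app v v' l) (app w w' l) i j k)"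
    unfolding split by (simp add: app_def 1(2) 2(2))
  ultimately show ?thesis
    unfolding is_sum_of_products_def by blast
qed

lemma is_sum_of_products_zero: "is_sum_of_products I (\<lambda>i j k. 0) 0"
  by (simp add: is_sum_of_products_def)

lemma is_sum_of_products_sum:
  assumes "finite J" "\<And>j. j \<in> J \<Longrightarrow> is_sum_of_products I (T j) r"
  shows "is_sum_of_products I (\<lambda>a b c. \<Sum>j\<in>J. T j a b c) (r * card J)"
  using assms
proof (induction J rule: finite_induct)
  case empty
  show ?case by (simp add: is_sum_of_products_zero)
next
  case (insert j J)
  then show ?case
    using is_sum_of_products_add[of I "T j" r "\<lambda>a b c. \<Sum>j\<in>J. T j a b c" "r * card J"] by simp
qed

lemma is_sum_of_products_in_tensor_space:
  assumes "is_sum_of_products I T r"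
  shows "T \<in> tensor_space I"
  using assms unfolding is_sum_of_products_def tensor_space_def vec_space_def tensor_prod_def
  by (auto intro!: sum.neutral)

lemma is_limit_of_rank_le_if_sum_of_products:
  assumes "is_sum_of_products I T r"
  shows "is_limit_of_rank_le I T r"
proof -
  have "tensor_rank I T \<le> r"
    unfolding tensor_rank_def by (rule Least_le) (rule assms)
  then show ?thesis
    unfolding is_limit_of_rank_le_def
    using is_sum_of_products_in_tensor_space[OF assms] by (intro exI[of _ "\<lambda>_. T"]) auto
qed

text \<open>A diagonal argument: each \<open>S n\<close> gets one approximant within
  \<open>inverse (Suc n)\<close> in all coordinates at once, which is possible since
  \<open>I\<close> is finite. This lets the upper bound nest three limits, each taken with the
  parameters of the outer ones fixed.\<close>

lemma is_limit_of_rank_le_closed: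
  assumes "finite I" and B: "\<And>n. is_limit_of_rank_le I (S n) r"
    and lim: "\<And>i j k. (\<lambda>n. S n i j k) \<longlonglongrightarrow> T i j k"
  shows "is_limit_of_rank_le I T r"
proof -
  have "\<exists>R. R \<in> tensor_space I \<and> tensor_rank I R \<le> r \<and>
      (\<forall>i j k. norm (R i j k - S n i j k) \<le> inverse (real (Suc n)))" for n
  proof -
    obtain Q where Q: "\<And>p. Q p \<in> tensor_space I" "\<And>p. tensor_rank I (Q p) \<le> r"
      "\<And>i j k. (\<lambda>p. Q p i j k) \<longlonglongrightarrow> S n i j k"
      using B[of n] unfolding is_limit_of_rank_le_def by blast
    have "\<forall>\<^sub>F p in sequentially. norm (Q p i j k - S n i j k) < inverse (real (Suc n))" for i j k
      using tendstoD[OF Q(3), of "inverse (real (Suc n))"] by (simp add: dist_norm)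
    then have "\<forall>\<^sub>F p in sequentially. \<forall>i\<in>I. \<forall>j\<in>I. \<forall>k\<in>I.
        norm (Q p i j k - S n i j k) < inverse (real (Suc n))"
      using \<open>finite I\<close> by (intro eventually_ball_finite ballI) auto
    then obtain p where p: "\<forall>i\<in>I. \<forall>j\<in>I. \<forall>k\<in>I.
        norm (Q p i j k - S n i j k) < inverse (real (Suc n))"
      by (auto simp: eventually_sequentially)
    have "norm (Q p i j k - S n i j k) \<le> inverse (real (Suc n))" for i j k
    \<comment> \<open>Outside \<open>I\<close> the approximants vanish identically, so their limit
      does too and the error there is zero.\<close>
    proof (cases "i \<in> I \<and> j \<in> I \<and> k \<in> I")
      case True
      then show ?thesis using p less_imp_le by blast
    next
      case False
      then have z: "Q p i j k = 0" for p using Q(1)[of p] by (auto simp: tensor_space_def)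
      then have "S n i j k = 0" using Q(3)[of i j k] by (simp add: LIMSEQ_const_iff)
      then show ?thesis using z by simp
    qed
    then show ?thesis using Q by blast
  qed
  then obtain R where R: "\<And>n. R n \<in> tensor_space I" "\<And>n. tensor_rank I (R n) \<le> r"
    "\<And>n i j k. norm (R n i j k - S n i j k) \<le> inverse (real (Suc n))"
    by metis
  have "(\<lambda>n. R n i j k) \<longlonglongrightarrow> T i j k" for i j k
  proof -
    have "(\<lambda>n. R n i j k - S n i j k) \<longlonglongrightarrow> 0"
      by (rule tendsto_norm_zero_cancel,
          rule tendsto_sandwich[OF _ _ tendsto_const LIMSEQ_inverse_real_of_nat])
        (intro always_eventually allI norm_ge_zero R(3))+
    from tendsto_add[OF this lim[of i j k]] show ?thesis by simp
  qed
  then show ?thesis unfolding is_limit_of_rank_le_def using R by blast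
qed

text \<open>The common form of all degenerations below: after the poles in the parameter cancel, the
  error has only terms of degree one and two. The limit is taken along
  \<open>1 / (n + 1)\<close>.\<close>

lemma is_limit_of_rank_le_quadratic_curve:
  assumes "finite I"
    and B: "\<And>e :: complex. e \<noteq> 0 \<Longrightarrow>
      is_limit_of_rank_le I (\<lambda>i j k. T i j k + e * G i j k + e\<^sup>2 * H i j k) r"
  shows "is_limit_of_rank_le I T r"
proof -
  define e where "e n = complex_of_real (inverse (real (Suc n)))" for n
  have "(\<lambda>n. complex_of_real (inverse (real (Suc n)))) \<longlonglongrightarrow> of_real 0"
    by (rule tendsto_of_real[OF LIMSEQ_inverse_real_of_nat])
  then have e0: "(\<lambda>n. e n) \<longlonglongrightarrow> 0"
    unfolding e_def by (simp only: of_real_0)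
  have ne: "e n \<noteq> 0" for n by (simp add: e_def del: of_nat_Suc)
  show ?thesis
    by (rule is_limit_of_rank_le_closed[OF \<open>finite I\<close> B[OF ne]])
      (auto intro!: tendsto_eq_intros e0)
qed

section \<open>Lower bound from conciseness\<close>

text \<open>Gaussian elimination, one equation per induction step: either equation \<open>r\<close>
  is trivial on \<open>I\<close>, or it has a pivot \<open>p\<close> whose unknown is
  eliminated.\<close>

lemma underdetermined_system_nontrivial_solution:
  fixes u :: "nat \<Rightarrow> 'i \<Rightarrow> complex"
  assumes "finite I" "r < card I"
  shows "\<exists>c. (\<exists>i\<in>I. c i \<noteq> 0) \<and> (\<forall>l<r. (\<Sum>i\<in>I. c i * u l i) = 0)"
  using assms
proof (induction r arbitrary: I u)
  case 0
  then have "I \<noteq> {}" by auto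
  then show ?case by (intro exI[of _ "\<lambda>_. 1"]) auto
next
  case (Suc r)
  show ?case
  proof (cases "\<forall>i\<in>I. u r i = 0")
    case True
    obtain c where "\<exists>i\<in>I. c i \<noteq> 0" "\<forall>l<r. (\<Sum>i\<in>I. c i * u l i) = 0"
      using Suc.IH[of I u] Suc.prems by auto
    then show ?thesis using True by (intro exI[of _ c]) (auto simp: less_Suc_eq)
  next
    case False
    then obtain p where p: "p \<in> I" "u r p \<noteq> 0" by auto
    let ?J = "I - {p}"
    \<comment> \<open>The substitution that solves equation \<open>r\<close> for the unknown at
      \<open>p\<close>; \<open>d\<close> below restores that unknown.\<close>
    define v where "v l i = u l i - u r i / u r p * u l p" for l i
    have "r < card ?J" using Suc.prems p by simp
    then obtain c where c: "\<exists>i\<in>?J. c i \<noteq> 0" "\<forall>l<r. (\<Sum>i\<in>?J. c i * v l i) = 0"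
      using Suc.IH[of ?J v] Suc.prems by auto
    define d where "d = c(p := - (\<Sum>i\<in>?J. c i * (u r i / u r p)))"
    have eq: "(\<Sum>i\<in>I. d i * u l i) = (\<Sum>i\<in>?J. c i * v l i)" for l
    proof -
      have "(\<Sum>i\<in>I. d i * u l i) = d p * u l p + (\<Sum>i\<in>?J. d i * u l i)"
        using Suc.prems p by (intro sum.remove) auto
      also have "(\<Sum>i\<in>?J. d i * u l i) = (\<Sum>i\<in>?J. c i * u l i)"
        by (intro sum.cong) (auto simp: d_def)
      also have "d p * u l p + (\<Sum>i\<in>?J. c i * u l i) = (\<Sum>i\<in>?J. c i * v l i)"
        by (simp add: d_def v_def right_diff_distrib sum_subtractf sum_distrib_right mult.assoc)
      finally show ?thesis .
    qed
    have "v r i = 0" for i using p by (simp add: v_def)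
    then have "\<forall>l<Suc r. (\<Sum>i\<in>I. d i * u l i) = 0"
      using c(2) by (auto simp: eq less_Suc_eq)
    moreover have "\<exists>i\<in>I. d i \<noteq> 0" using c(1) by (auto simp: d_def)
    ultimately show ?thesis by blast
  qed
qed

text \<open>Diagonal dominance: in a row \<open>p\<close> where \<open>norm (c p)\<close> is
  maximal, the relation writes \<open>- c p\<close> as the sum of the \<open>c j\<close> times the
  deviations from the identity. For nonzero \<open>c\<close> these are \<open>card I\<close> terms,
  each below \<open>norm (c p) / card I\<close>, so they cannot add up to it.\<close>

lemma near_identity_matrix_kernel_trivial:
  fixes M :: "'i \<Rightarrow> 'i \<Rightarrow> complex"
  assumes "finite I"
    and near: "\<And>p i. p \<in> I \<Longrightarrow> i \<in> I \<Longrightarrow>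
      norm (M p i - (if i = p then 1 else 0)) < inverse (real (card I))"
    and ker: "\<And>p. p \<in> I \<Longrightarrow> (\<Sum>i\<in>I. c i * M p i) = 0"
    and "i \<in> I"
  shows "c i = 0"
proof (rule ccontr)
  assume "c i \<noteq> 0"
  define N where "N = Max ((\<lambda>i. norm (c i)) ` I)"
  have N: "norm (c j) \<le> N" if "j \<in> I" for j
    using that \<open>finite I\<close> by (auto simp: N_def)
  have "N > 0" using N[OF \<open>i \<in> I\<close>] \<open>c i \<noteq> 0\<close> by (smt (verit) zero_less_norm_iff)
  have "N \<in> (\<lambda>i. norm (c i)) ` I"
    unfolding N_def using \<open>finite I\<close> \<open>i \<in> I\<close> by (intro Max_in) auto
  then obtain p where p: "p \<in> I" "norm (c p) = N" by auto
  have "(\<Sum>j\<in>I. c j * (M p j - (if j = p then 1 else 0)))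
      = (\<Sum>j\<in>I. c j * M p j) - (\<Sum>j\<in>I. if j = p then c j else 0)"
    unfolding sum_subtractf[symmetric] by (intro sum.cong) (auto simp: algebra_simps)
  also have "\<dots> = - c p"
    using ker[OF p(1)] p(1) \<open>finite I\<close> by simp
  finally have "N = norm (\<Sum>j\<in>I. c j * (M p j - (if j = p then 1 else 0)))"
    using p by simp
  also have "\<dots> \<le> (\<Sum>j\<in>I. norm (c j * (M p j - (if j = p then 1 else 0))))"
    by (rule norm_sum)
  also have "\<dots> < (\<Sum>j\<in>I. N * inverse (real (card I)))"
  proof (rule sum_strict_mono)
    fix j assume j: "j \<in> I"
    have "norm (c j * (M p j - (if j = p then 1 else 0)))
        \<le> N * norm (M p j - (if j = p then 1 else 0))"
      unfolding norm_mult using N[OF j] by (rule mult_right_mono) simp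
    also have "\<dots> < N * inverse (real (card I))"
      using near[OF p(1) j] \<open>N > 0\<close> by (rule mult_strict_left_mono)
    finally show "norm (c j * (M p j - (if j = p then 1 else 0))) < N * inverse (real (card I))" .
  qed (use \<open>finite I\<close> \<open>i \<in> I\<close> in auto)
  also have "\<dots> = N"
    using \<open>finite I\<close> \<open>i \<in> I\<close> by (auto simp: field_simps card_gt_0_iff)
  finally show False by simp
qed

lemma card_le_if_is_limit_of_rank_le:
  assumes "finite I" and B: "is_limit_of_rank_le I T r"
    and iso: "\<And>p i. p \<in> I \<Longrightarrow> i \<in> I \<Longrightarrow> T i (f p) (g p) = (if i = p then 1 else 0)"
  shows "card I \<le> r"
proof (rule ccontr)
  assume "\<not> card I \<le> r"
  obtain S where S: "\<And>n. S n \<in> tensor_space I" "\<And>n. tensor_rank I (S n) \<le> r"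
    "\<And>i j k. (\<lambda>n. S n i j k) \<longlonglongrightarrow> T i j k"
    using B unfolding is_limit_of_rank_le_def by blast
  have pos: "inverse (real (card I)) > 0" using \<open>\<not> card I \<le> r\<close> by simp
  have "\<forall>\<^sub>F n in sequentially. norm (S n i (f p) (g p) - T i (f p) (g p)) < inverse (real (card I))"
    for i p
    using tendstoD[OF S(3) pos] by (simp add: dist_norm)
  then have "\<forall>\<^sub>F n in sequentially. \<forall>p\<in>I. \<forall>i\<in>I.
      norm (S n i (f p) (g p) - T i (f p) (g p)) < inverse (real (card I))"
    using \<open>finite I\<close> by (intro eventually_ball_finite ballI) auto
  then obtain n where n: "\<forall>p\<in>I. \<forall>i\<in>I.
      norm (S n i (f p) (g p) - T i (f p) (g p)) < inverse (real (card I))"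
    by (auto simp: eventually_sequentially)
  have "is_sum_of_products I (S n) (tensor_rank I (S n))"
    unfolding tensor_rank_def by (rule LeastI_ex[OF ex_is_sum_of_products[OF \<open>finite I\<close> S(1)]])
  then obtain u v w where
    uvw: "S n = (\<lambda>i j k. \<Sum>l<tensor_rank I (S n). tensor_prod (u l) (v l) (w l) i j k)"
    unfolding is_sum_of_products_def by blast
  \<comment> \<open>Since \<open>c\<close> annihilates every first factor \<open>u l\<close>, it
    annihilates \<open>S n\<close> in the first index. On the pairs \<open>(f p, g p)\<close> this
    makes \<open>c\<close> a kernel vector of a matrix close to the identity.\<close>
  obtain c where c: "\<exists>i\<in>I. c i \<noteq> 0" "\<forall>l<tensor_rank I (S n). (\<Sum>i\<in>I. c i * u l i) = 0"
    using underdetermined_system_nontrivial_solution[OF \<open>finite I\<close>, of "tensor_rank I (S n)" u]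
      S(2)[of n] \<open>\<not> card I \<le> r\<close> by auto
  have "(\<Sum>i\<in>I. c i * S n i j k) = 0" for j k
  proof -
    have "(\<Sum>i\<in>I. c i * S n i j k)
        = (\<Sum>i\<in>I. \<Sum>l<tensor_rank I (S n). c i * u l i * (v l j * w l k))"
      by (subst uvw) (simp add: tensor_prod_def sum_distrib_left mult.assoc)
    also have "\<dots> = (\<Sum>l<tensor_rank I (S n). (\<Sum>i\<in>I. c i * u l i) * (v l j * w l k))"
      by (subst sum.swap) (simp add: sum_distrib_right)
    also have "\<dots> = 0" using c(2) by simp
    finally show ?thesis .
  qed
  moreover have "norm (S n i (f p) (g p) - (if i = p then 1 else 0)) < inverse (real (card I))"
    if "p \<in> I" "i \<in> I" for p i
    using n that iso[OF that] by metis
  ultimately have "c i = 0" if "i \<in> I" for i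
    using near_identity_matrix_kernel_trivial[OF \<open>finite I\<close>, of "\<lambda>p i. S n i (f p) (g p)" c i] that
    by blast
  then show False using c(1) by blast
qed

section \<open>Border rank decomposition\<close>

definition cube :: "('i \<Rightarrow> complex) \<Rightarrow> 'i tensor3" where
  "cube u = tensor_prod u u u"

text \<open>Three times the symmetric product of \<open>u\<close>, \<open>u\<close>,
  \<open>v\<close>, that is, the derivative of \<open>cube\<close> at \<open>u\<close> in direction
  \<open>v\<close>.\<close>

definition square_times :: "('i \<Rightarrow> complex) \<Rightarrow> ('i \<Rightarrow> complex) \<Rightarrow> 'i tensor3" where
  "square_times u v = (\<lambda>i j k. u i * u j * v k + u i * v j * u k + v i * u j * u k)"

lemma is_sum_of_products_cube:
  assumes "u \<in> vec_space I"
  shows "is_sum_of_products I (\<lambda>i j k. c * cube u i j k) 1"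
  unfolding is_sum_of_products_def
  using assms
  by (intro exI[of _ "\<lambda>_ i. c * u i"] exI[of _ "\<lambda>_. u"])
    (auto simp: vec_space_def cube_def tensor_prod_def mult.assoc)

lemma vec_space_add: "u \<in> vec_space I \<Longrightarrow> v \<in> vec_space I \<Longrightarrow> (\<lambda>i. u i + v i) \<in> vec_space I"
  and vec_space_diff: "u \<in> vec_space I \<Longrightarrow> v \<in> vec_space I \<Longrightarrow> (\<lambda>i. u i - v i) \<in> vec_space I"
  and vec_space_scale: "u \<in> vec_space I \<Longrightarrow> (\<lambda>i. c * u i) \<in> vec_space I"
  by (auto simp: vec_space_def)

lemma vec_space_sum:
  "(\<And>j. j \<in> J \<Longrightarrow> v j \<in> vec_space I) \<Longrightarrow> (\<lambda>i. \<Sum>j\<in>J. v j i) \<in> vec_space I"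
  by (auto simp: vec_space_def intro!: sum.neutral)

lemmas vec_space_intros = vec_space_add vec_space_diff vec_space_scale vec_space_sum

text \<open>Exact Taylor expansion at \<open>q\<close>, scaled so that the tangent term has
  coefficient one whatever the weight \<open>c\<close>. The pole \<open>c / t * cube q\<close>
  remains to be cancelled.\<close>

lemma cube_tangent:
  assumes "t \<noteq> 0" "c \<noteq> 0"
  shows "c / t * cube (\<lambda>i. q i + t / c * e i) i j k =
    c / t * cube q i j k + square_times q e i j k
    + t * (1 / c * square_times e q i j k) + t\<^sup>2 * (1 / c\<^sup>2 * cube e i j k)"
  using assms
  by (simp add: cube_def square_times_def tensor_prod_def field_simps power2_eq_square)

text \<open>The weights 1, -4, 6, -4, 1 form the fourth finite difference of the cubic curve
  \<open>s\<close> to \<open>cube (a + s b)\<close> at \<open>s\<close> = -2, ..., 2, which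
  vanishes.\<close>

lemma five_cubes_relation:
  "6 * cube a i j k - 4 * cube (\<lambda>i. a i + b i) i j k - 4 * cube (\<lambda>i. a i - b i) i j k
    + cube (\<lambda>i. a i + 2 * b i) i j k + cube (\<lambda>i. a i - 2 * b i) i j k = 0"
  by (simp add: cube_def tensor_prod_def algebra_simps)

text \<open>Weighting five cubes by the relation over \<open>t\<close> cancels the poles, and moving
  three of the points yields arbitrary tangent terms there. The remainder \<open>R\<close> stays
  fixed as \<open>t\<close> tends to zero, so further cubes can be added at their own cost.\<close>

lemma tangents_at_three_collinear_points:
  assumes "finite I" and ab: "a \<in> vec_space I" "b \<in> vec_space I"
    and e: "e0 \<in> vec_space I" "e1 \<in> vec_space I" "e2 \<in> vec_space I"
    and R: "is_sum_of_products I R s"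
  shows "is_limit_of_rank_le I (\<lambda>i j k. square_times a e0 i j k
    + square_times (\<lambda>i. a i + b i) e1 i j k + square_times (\<lambda>i. a i - b i) e2 i j k + R i j k)
    (5 + s)" (is "is_limit_of_rank_le I ?T _")
proof (rule is_limit_of_rank_le_quadratic_curve[OF \<open>finite I\<close>])
  let ?p = "\<lambda>i. a i + b i" and ?q = "\<lambda>i. a i - b i"
  let ?G = "\<lambda>i j k. 1/6 * square_times e0 a i j k + 1/(-4) * square_times e1 ?p i j k
    + 1/(-4) * square_times e2 ?q i j k"
  let ?H = "\<lambda>i j k. 1/6\<^sup>2 * cube e0 i j k + 1/(-4)\<^sup>2 * cube e1 i j k + 1/(-4)\<^sup>2 * cube e2 i j k"
  fix t :: complex assume t: "t \<noteq> 0"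
  let ?S = "\<lambda>i j k. 6/t * cube (\<lambda>i. a i + t/6 * e0 i) i j k
    + ((-4)/t * cube (\<lambda>i. ?p i + t/(-4) * e1 i) i j k
    + ((-4)/t * cube (\<lambda>i. ?q i + t/(-4) * e2 i) i j k
    + (1/t * cube (\<lambda>i. a i + 2 * b i) i j k
    + (1/t * cube (\<lambda>i. a i - 2 * b i) i j k + R i j k))))"
  have "is_sum_of_products I ?S (1 + (1 + (1 + (1 + (1 + s)))))"
    by (intro is_sum_of_products_add is_sum_of_products_cube vec_space_intros ab e R)
  moreover have "?S = (\<lambda>i j k. ?T i j k + t * ?G i j k + t\<^sup>2 * ?H i j k)"
  proof (intro ext)
    fix i j k
    have "?S i j k - (?T i j k + t * ?G i j k + t\<^sup>2 * ?H i j k) = 1/t *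
      (6 * cube a i j k - 4 * cube ?p i j k - 4 * cube ?q i j k
      + cube (\<lambda>i. a i + 2 * b i) i j k + cube (\<lambda>i. a i - 2 * b i) i j k)"
      using t by (subst (1 2 3) cube_tangent) (auto simp: algebra_simps)
    then show "?S i j k = ?T i j k + t * ?G i j k + t\<^sup>2 * ?H i j k"
      by (simp only: five_cubes_relation mult_zero_right right_minus_eq)
  qed
  ultimately show "is_limit_of_rank_le I (\<lambda>i j k. ?T i j k + t * ?G i j k + t\<^sup>2 * ?H i j k) (5 + s)"
    using is_limit_of_rank_le_if_sum_of_products by (simp add: numeral_eq_Suc)
qed

text \<open>In \<open>cube (q + t l) / t^2\<close> the two terms with poles are
  \<open>square_times q\<close> of \<open>q / (3 t^2)\<close> and of \<open>l / t\<close>. Both are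
  tangent terms at \<open>q\<close>, so changing \<open>e\<close> removes them at no cost in
  rank.\<close>

lemma second_order_cubes:
  assumes "t \<noteq> 0"
  shows "square_times q (\<lambda>i. e i - (\<Sum>j\<in>J. c / t\<^sup>2 * (1/3 * q i + t * l j i))) x y z
      + (\<Sum>j\<in>J. c / t\<^sup>2 * cube (\<lambda>i. q i + t * l j i) x y z)
    = square_times q e x y z + (\<Sum>j\<in>J. c * square_times (l j) q x y z)
      + t * (\<Sum>j\<in>J. c * cube (l j) x y z)"
proof -
  have "square_times q (\<lambda>i. e i - (\<Sum>j\<in>J. c / t\<^sup>2 * (1/3 * q i + t * l j i))) x y z
      = square_times q e x y z
        - (\<Sum>j\<in>J. square_times q (\<lambda>i. c / t\<^sup>2 * (1/3 * q i + t * l j i)) x y z)"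
    by (simp only: square_times_def right_diff_distrib left_diff_distrib sum.distrib
        sum_distrib_left[symmetric] sum_distrib_right[symmetric]) (simp only: algebra_simps)
  moreover have "c / t\<^sup>2 * cube (\<lambda>i. q i + t * l j i) x y z
      = square_times q (\<lambda>i. c / t\<^sup>2 * (1/3 * q i + t * l j i)) x y z
        + c * square_times (l j) q x y z + t * (c * cube (l j) x y z)" for j
    using assms
    by (simp add: cube_def square_times_def tensor_prod_def field_simps power2_eq_square)
  ultimately show ?thesis
    by (simp add: sum.distrib sum_distrib_left)
qed

lemma squares_times_three_collinear_points:
  assumes "finite I" "finite J" and ab: "a \<in> vec_space I" "b \<in> vec_space I"
    and e: "e0 \<in> vec_space I" "e1 \<in> vec_space I" "e2 \<in> vec_space I"
    and l: "\<And>j. j \<in> J \<Longrightarrow> l0 j \<in> vec_space I" "\<And>j. j \<in> J \<Longrightarrow> l1 j \<in> vec_space I"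
      "\<And>j. j \<in> J \<Longrightarrow> l2 j \<in> vec_space I"
  shows "is_limit_of_rank_le I (\<lambda>i j k. square_times a e0 i j k
    + square_times (\<lambda>i. a i + b i) e1 i j k + square_times (\<lambda>i. a i - b i) e2 i j k
    + (\<Sum>n\<in>J. c0 * square_times (l0 n) a i j k) + (\<Sum>n\<in>J. c1 * square_times (l1 n) (\<lambda>i. a i + b i) i j k)
    + (\<Sum>n\<in>J. c2 * square_times (l2 n) (\<lambda>i. a i - b i) i j k))
    (5 + 3 * card J)" (is "is_limit_of_rank_le I ?T _")
proof (rule is_limit_of_rank_le_quadratic_curve[OF \<open>finite I\<close>])
  let ?p = "\<lambda>i. a i + b i" and ?q = "\<lambda>i. a i - b i"
  let ?G = "\<lambda>i j k. (\<Sum>n\<in>J. c0 * cube (l0 n) i j k) + (\<Sum>n\<in>J. c1 * cube (l1 n) i j k)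
    + (\<Sum>n\<in>J. c2 * cube (l2 n) i j k)"
  fix t :: complex assume t: "t \<noteq> 0"
  let ?e = "\<lambda>q e c l i. e i - (\<Sum>j\<in>J. c / t\<^sup>2 * (1/3 * q i + t * l j i))"
  let ?r = "\<lambda>q c l i j k. \<Sum>n\<in>J. c / t\<^sup>2 * cube (\<lambda>i. q i + t * l n i) i j k"
  let ?R = "\<lambda>i j k. ?r a c0 l0 i j k + (?r ?p c1 l1 i j k + ?r ?q c2 l2 i j k)"
  have "is_sum_of_products I ?R (1 * card J + (1 * card J + 1 * card J))"
    by (intro is_sum_of_products_add is_sum_of_products_sum is_sum_of_products_cube
        vec_space_intros ab l \<open>finite J\<close>)
  \<comment> \<open>For fixed \<open>t\<close> the corrected vectors \<open>?e\<close> are ordinary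
    tangent directions, so only the cubes in \<open>?R\<close> add to the 5.\<close>
  then have "is_limit_of_rank_le I (\<lambda>i j k. square_times a (?e a e0 c0 l0) i j k
    + square_times ?p (?e ?p e1 c1 l1) i j k + square_times ?q (?e ?q e2 c2 l2) i j k + ?R i j k)
    (5 + (1 * card J + (1 * card J + 1 * card J)))"
    by (intro tangents_at_three_collinear_points vec_space_intros ab e l \<open>finite I\<close>)
  \<comment> \<open>The error is linear in \<open>t\<close>; the summand
    \<open>t\<^sup>2 * 0\<close> supplies the shape of the quadratic curve lemma.\<close>
  moreover have "(\<lambda>i j k. square_times a (?e a e0 c0 l0) i j k
    + square_times ?p (?e ?p e1 c1 l1) i j k + square_times ?q (?e ?q e2 c2 l2) i j k + ?R i j k)
    = (\<lambda>i j k. ?T i j k + t * ?G i j k + t\<^sup>2 * 0)" (is "?L = ?L'")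
  proof (intro ext)
    fix i j k
    note s = second_order_cubes[OF t, where J = J and x = i and y = j and z = k]
    have combine: "x0 + x1 + x2 + (y0 + (y1 + y2))
        = u0 + u1 + u2 + v0 + v1 + v2 + t * (g0 + g1 + g2) + t\<^sup>2 * 0"
      if "x0 + y0 = u0 + v0 + t * g0" "x1 + y1 = u1 + v1 + t * g1" "x2 + y2 = u2 + v2 + t * g2"
      for x0 x1 x2 y0 y1 y2 u0 u1 u2 v0 v1 v2 g0 g1 g2 :: complex
      using that by algebra
    show "?L i j k = ?L' i j k"
      by (rule combine[OF s s s])
  qed
  moreover have "1 * card J + (1 * card J + 1 * card J) = 3 * card J" by simp
  ultimately show "is_limit_of_rank_le I (\<lambda>i j k. ?T i j k + t * ?G i j k + t\<^sup>2 * 0) (5 + 3 * card J)"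
    by (simp only:)
qed

text \<open>The pencil of quadrics \<open>2xy\<close>, \<open>2xz\<close> is a limit of pencils that are simultaneously
  diagonalisable in three squares.\<close>

lemma degenerate_pencil_diagonalisation:
  assumes "t \<noteq> 0"
  shows "- 2 / t * square_times x a i j k
      + 1 / t * square_times (\<lambda>i. x i + t * (1/2 * (y i + z i))) (\<lambda>i. a i + b i) i j k
      + 1 / t * square_times (\<lambda>i. x i + t * (1/2 * (y i - z i))) (\<lambda>i. a i - b i) i j k
    = 6 * sym_prod a x y i j k + 6 * sym_prod b x z i j k
      + t * (1/4 * square_times (\<lambda>i. y i + z i) (\<lambda>i. a i + b i) i j k
        + 1/4 * square_times (\<lambda>i. y i - z i) (\<lambda>i. a i - b i) i j k)"
  using assms
  by (simp add: square_times_def sym_prod_def tensor_prod_def field_simps)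

text \<open>For fixed nonzero \<open>t\<close> each pencil becomes three squares, one for each of
  \<open>a\<close>, \<open>a + b\<close>, \<open>a - b\<close>, with weights -2/t, 1/t, 1/t
  independent of \<open>n\<close>. The preceding bound then applies with three cubes per
  \<open>n\<close>.\<close>

lemma sum_of_degenerate_pencils:
  assumes "finite I" "finite J" and ab: "a \<in> vec_space I" "b \<in> vec_space I"
    and e: "e0 \<in> vec_space I" "e1 \<in> vec_space I" "e2 \<in> vec_space I"
    and xyz: "\<And>n. n \<in> J \<Longrightarrow> x n \<in> vec_space I" "\<And>n. n \<in> J \<Longrightarrow> y n \<in> vec_space I"
      "\<And>n. n \<in> J \<Longrightarrow> z n \<in> vec_space I"
  shows "is_limit_of_rank_le I (\<lambda>i j k. square_times a e0 i j k
    + square_times (\<lambda>i. a i + b i) e1 i j k + square_times (\<lambda>i. a i - b i) e2 i j k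
    + (\<Sum>n\<in>J. 6 * sym_prod a (x n) (y n) i j k + 6 * sym_prod b (x n) (z n) i j k))
    (5 + 3 * card J)" (is "is_limit_of_rank_le I ?T _")
proof (rule is_limit_of_rank_le_quadratic_curve[OF \<open>finite I\<close>])
  let ?p = "\<lambda>i. a i + b i" and ?q = "\<lambda>i. a i - b i"
  let ?G = "\<lambda>i j k. \<Sum>n\<in>J. 1/4 * square_times (\<lambda>i. y n i + z n i) ?p i j k
    + 1/4 * square_times (\<lambda>i. y n i - z n i) ?q i j k"
  fix t :: complex assume t: "t \<noteq> 0"
  let ?S = "\<lambda>i j k. square_times a e0 i j k + square_times ?p e1 i j k + square_times ?q e2 i j k
    + (\<Sum>n\<in>J. - 2 / t * square_times (x n) a i j k)
    + (\<Sum>n\<in>J. 1 / t * square_times (\<lambda>i. x n i + t * (1/2 * (y n i + z n i))) ?p i j k)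
    + (\<Sum>n\<in>J. 1 / t * square_times (\<lambda>i. x n i + t * (1/2 * (y n i - z n i))) ?q i j k)"
  have "is_limit_of_rank_le I ?S (5 + 3 * card J)"
    by (intro squares_times_three_collinear_points vec_space_intros ab e xyz \<open>finite I\<close> \<open>finite J\<close>)
  moreover have "?S = (\<lambda>i j k. ?T i j k + t * ?G i j k + t\<^sup>2 * 0)"
  proof (intro ext)
    fix i j k
    have "(\<Sum>n\<in>J. - 2 / t * square_times (x n) a i j k)
      + (\<Sum>n\<in>J. 1 / t * square_times (\<lambda>i. x n i + t * (1/2 * (y n i + z n i))) ?p i j k)
      + (\<Sum>n\<in>J. 1 / t * square_times (\<lambda>i. x n i + t * (1/2 * (y n i - z n i))) ?q i j k)
      = (\<Sum>n\<in>J. 6 * sym_prod a (x n) (y n) i j k + 6 * sym_prod b (x n) (z n) i j k)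
        + t * ?G i j k"
      unfolding sum.distrib[symmetric] sum_distrib_left
      by (intro sum.cong refl degenerate_pencil_diagonalisation[OF t])
    then show "?S i j k = ?T i j k + t * ?G i j k + t\<^sup>2 * 0"
      by (simp only: add.assoc mult_zero_right add_0_right)
  qed
  ultimately show "is_limit_of_rank_le I (\<lambda>i j k. ?T i j k + t * ?G i j k + t\<^sup>2 * 0) (5 + 3 * card J)"
    by simp
qed

section \<open>The tensors \<open>T_HW m\<close>\<close>

lemma basis_vec_in_vec_space: "i \<in> I \<Longrightarrow> basis_vec i \<in> vec_space I"
  by (auto simp: basis_vec_def vec_space_def)

lemma T_HW_limit: "is_limit_of_rank_le (hw_basis m) (T_HW m) (3 * m + 5)"
proof -
  let ?I = "hw_basis m" and ?v = basis_vec
  \<comment> \<open>Obtained by comparing the coefficients of the squares of \<open>A1\<close> and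
    \<open>A2\<close> and of their product: these must be \<open>B1\<close>, \<open>B2\<close> and
    twice \<open>B0\<close>, up to the common factor 3.\<close>
  let ?e0 = "\<lambda>i. ?v B1 i - ?v B2 i" and ?e1 = "\<lambda>i. 1/2 * (?v B2 i + ?v B0 i)"
    and ?e2 = "\<lambda>i. 1/2 * (?v B2 i - ?v B0 i)"
  let ?S = "\<lambda>i j k. square_times (?v A1) ?e0 i j k
    + square_times (\<lambda>i. ?v A1 i + ?v A2 i) ?e1 i j k
    + square_times (\<lambda>i. ?v A1 i - ?v A2 i) ?e2 i j k
    + (\<Sum>n\<in>{1..m}. 6 * sym_prod (?v A1) (?v (Xj n)) (?v (Yj n)) i j k
      + 6 * sym_prod (?v A2) (?v (Xj n)) (?v (Zj n)) i j k)"
  have "is_limit_of_rank_le ?I ?S (5 + 3 * card {1..m})"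
    by (intro sum_of_degenerate_pencils vec_space_intros basis_vec_in_vec_space finite_hw_basis
        finite_atLeastAtMost) (auto simp: hw_basis_def)
  moreover have "?S = T_HW m"
  proof (intro ext)
    fix i j k
    have "square_times a (\<lambda>i. c i - d i) i j k
      + square_times (\<lambda>i. a i + b i) (\<lambda>i. 1/2 * (d i + e i)) i j k
      + square_times (\<lambda>i. a i - b i) (\<lambda>i. 1/2 * (d i - e i)) i j k
      = 6 * sym_prod a b e i j k + 3 * sym_prod a a c i j k + 3 * sym_prod b b d i j k"
      for a b c d e :: "hw_label \<Rightarrow> complex"
      by (simp add: square_times_def sym_prod_def tensor_prod_def field_simps)
    then show "?S i j k = T_HW m i j k"
      by (simp only: T_HW_def Let_def sum_distrib_left distrib_left)
  qed
  ultimately show ?thesis by (simp add: add.commute)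
qed

text \<open>Together with \<open>isolating_right\<close>, this picks a monomial of
  \<open>T_HW m\<close> containing the given label and returns its other two factors, chosen so that
  no other monomial contains both.\<close>

fun isolating_left :: "hw_label \<Rightarrow> hw_label" where
  "isolating_left A1 = A2"
| "isolating_left A2 = A1"
| "isolating_left (Xj n) = A1"
| "isolating_left (Yj n) = A1"
| "isolating_left (Zj n) = A2"
| "isolating_left B0 = A1"
| "isolating_left B1 = A1"
| "isolating_left B2 = A2"

fun isolating_right :: "hw_label \<Rightarrow> hw_label" where
  "isolating_right A1 = B0"
| "isolating_right A2 = B0"
| "isolating_right (Xj n) = Yj n"
| "isolating_right (Yj n) = Xj n"
| "isolating_right (Zj n) = Xj n"
| "isolating_right B0 = A2"
| "isolating_right B1 = A1"
| "isolating_right B2 = A2"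

text \<open>The entry at \<open>i = p\<close> is exactly 1 because the coefficients 6 and 3 cancel
  the 1/6 of \<open>sym_prod\<close> times the one or two permutations that contribute.\<close>

lemma T_HW_isolating:
  assumes "p \<in> hw_basis m"
  shows "T_HW m i (isolating_left p) (isolating_right p) = (if i = p then 1 else 0)"
proof -
  note defs = sym_prod_def tensor_prod_def basis_vec_def
  let ?x = "\<lambda>n. basis_vec (Xj n)" and ?y = "\<lambda>n. basis_vec (Yj n)" and ?z = "\<lambda>n. basis_vec (Zj n)"
  let ?s = "\<lambda>n i j k. sym_prod (basis_vec A1) (?x n) (?y n) i j k
    + sym_prod (basis_vec A2) (?x n) (?z n) i j k"
  \<comment> \<open>The eight kinds of pairs that occur, in a form that lets
    \<open>sum.delta\<close> collapse the sum over \<open>j\<close>.\<close>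
  have s:
    "?s n' i A1 (Yj n) = (if n' = n then if i = Xj n then 1/6 else 0 else 0)"
    "?s n' i A1 (Xj n) = (if n' = n then if i = Yj n then 1/6 else 0 else 0)"
    "?s n' i A2 (Xj n) = (if n' = n then if i = Zj n then 1/6 else 0 else 0)"
    "?s n' i A1 A1 = 0" "?s n' i A1 A2 = 0" "?s n' i A2 A2 = 0"
    "?s n' i A1 B0 = 0" "?s n' i A2 B0 = 0" for n n'
    by (cases i; simp add: defs)+
  show ?thesis
    using assms unfolding T_HW_def Let_def
    by (cases p; simp only: isolating_left.simps isolating_right.simps s sum.delta
        finite_atLeastAtMost sum.neutral_const; cases i; simp add: hw_basis_def defs image_iff)
qed

theorem theorem3p2:
  fixes m :: nat
  shows "border_rank (hw_basis m) (T_HW m) = 3 * m + 5"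
  unfolding border_rank_def
proof (rule Least_equality)
  show "is_limit_of_rank_le (hw_basis m) (T_HW m) (3 * m + 5)"
    by (rule T_HW_limit)
next
  fix r assume "is_limit_of_rank_le (hw_basis m) (T_HW m) r"
  then have "card (hw_basis m) \<le> r"
    by (rule card_le_if_is_limit_of_rank_le[OF finite_hw_basis]) (rule T_HW_isolating)
  then show "3 * m + 5 \<le> r" by (simp add: card_hw_basis)
qed

end
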